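(* Let $W_n$ ($n \ge 2$) denote the number of white beads in a random necklace of size $n$ generated by the necklace process, and let $$W(z,u) = \sum_{n\ge 2}\sum_{k\ge 1} \mathbb{P}(W_n = k)\, z^{n-1} u^k$$ be the corresponding shifted bivariate probability generating function. Then $$W(z,u) = \frac{u}{\sqrt{1-u}\,\coth\big(z\sqrt{1-u}\,\big) - 1},$$ or, equivalently, with $\alpha := \sqrt{1-u}$, $$W(z,u) = u\,\frac{\exp(z\alpha) - \exp(-z\alpha)}{\exp(z\alpha)(\alpha-1) + \exp(-z\alpha)(\alpha+1)} = u\,\frac{\exp(2z\alpha) - 1}{\exp(2z\alpha)(\alpha-1) + \alpha + 1}.$$
   Context: The necklace process constructs necklaces (circular arrangements) of black and white beads. It starts with the necklace of size $2$ consisting of one black and one white bead. Beads are then inserted one at a time: a necklace of size $n$ (i.e., with $n$ beads) has $n$ positions between two adjacent beads (the necklace of size $2$ has $2$ such positions), and a new bead is inserted at one of these $n$ positions. The color of the new bead is determined by its two neighbors: the new bead is white if and only if both of its neighbors are black; otherwise it is black. A random necklace of size $n$ is obtained by choosing, in each insertion step, the position uniformly at random among all available positions, independently of the previous choices (equivalently, one of the $(n-1)!$ possible construction sequences is chosen uniformly at random). The identities are understood as identities of power series in $z$ around $z=0$ (with removable singularities, in particular at $z = 0$ and at $u=1$, filled in by continuity); the right-hand sides are even in $\alpha$, so the choice of the branch of the square root is irrelevant. *)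

theory Defs
  imports "HOL-Probability.Probability"
begin

datatype bead = Black | White

text \<open>
  A necklace is represented by the list of its beads read off around the circle from an arbitrary
  starting point. Position \<open>i\<close> of a necklace of size \<open>n\<close> (where \<open>i < n\<close>) is the gap between bead
  \<open>i\<close> and bead \<open>(i + 1) mod n\<close>; inserting at position \<open>n - 1\<close> thus appends the new bead at the end
  of the list, between the last and the first bead.
\<close>

definition new_bead :: "bead \<Rightarrow> bead \<Rightarrow> bead" where
  "new_bead a b = (if a = Black \<and> b = Black then White else Black)"

definition insert_bead :: "bead list \<Rightarrow> nat \<Rightarrow> bead list" where
  "insert_bead xs i =
     take (Suc i) xs @ [new_bead (xs ! i) (xs ! (Suc i mod length xs))] @ drop (Suc i) xs"

primrec necklace_process :: "nat \<Rightarrow> bead list pmf" where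
  "necklace_process 0 = return_pmf [Black, White]"
| "necklace_process (Suc m) =
     bind_pmf (necklace_process m) (\<lambda>xs. map_pmf (insert_bead xs) (pmf_of_set {..<length xs}))"

text \<open>Since the process starts at size 2, a necklace of size \<open>n\<close> arises after \<open>n - 2\<close> insertions;
  \<open>random_necklace n\<close> is meaningful for \<open>n \<ge> 2\<close> only.\<close>

definition random_necklace :: "nat \<Rightarrow> bead list pmf" where
  "random_necklace n = necklace_process (n - 2)"

definition white_beads :: "bead list \<Rightarrow> nat" where
  "white_beads xs = count_list xs White"

definition W_index :: "(nat \<times> nat) set" where
  "W_index = {2..} \<times> {1..}"

definition W_term :: "complex \<Rightarrow> complex \<Rightarrow> nat \<times> nat \<Rightarrow> complex" where
  "W_term z u = (\<lambda>(n, k).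
     of_real (measure_pmf.prob (random_necklace n) {xs. white_beads xs = k}) * z ^ (n - 1) * u ^ k)"

definition W :: "complex \<Rightarrow> complex \<Rightarrow> complex" where
  "W z u = (\<Sum>\<^sub>\<infinity>p\<in>W_index. W_term z u p)"

text \<open>
  \<open>has_filled_value f D p v\<close>: the function \<open>f\<close>, given by an expression that makes sense on \<open>D\<close>
  only, has value \<open>v\<close> at \<open>p\<close> after filling in removable singularities by continuity. The
  limit-point condition prevents the limit from being vacuous.
\<close>

definition has_filled_value ::
  "('a::topological_space \<Rightarrow> 'b::topological_space) \<Rightarrow> 'a set \<Rightarrow> 'a \<Rightarrow> 'b \<Rightarrow> bool" where
  "has_filled_value f D p v \<longleftrightarrow>
     (if p \<in> D then f p = v else p islimpt D \<and> (f \<longlongrightarrow> v) (at p within D))"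

definition coth :: "complex \<Rightarrow> complex" where
  "coth x = cosh x / sinh x"

text \<open>
  Each closed form comes with the set of all \<open>(z, u)\<close> at which none of its denominators vanishes.
  As all three forms are even in \<open>\<alpha>\<close>, the principal square root is as good as the other one,
  and its branch cut causes no discontinuity.
\<close>

definition alpha :: "complex \<Rightarrow> complex" where
  "alpha u = csqrt (1 - u)"

definition coth_form :: "complex \<times> complex \<Rightarrow> complex" where
  "coth_form = (\<lambda>(z, u). u / (csqrt (1 - u) * coth (z * csqrt (1 - u)) - 1))"

definition coth_dom :: "(complex \<times> complex) set" where
  "coth_dom = {(z, u). sinh (z * csqrt (1 - u)) \<noteq> 0 \<and>
     csqrt (1 - u) * coth (z * csqrt (1 - u)) - 1 \<noteq> 0}"

definition exp_form :: "complex \<times> complex \<Rightarrow> complex" where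
  "exp_form = (\<lambda>(z, u). let \<alpha> = alpha u in
     u * ((exp (z * \<alpha>) - exp (- z * \<alpha>)) / (exp (z * \<alpha>) * (\<alpha> - 1) + exp (- z * \<alpha>) * (\<alpha> + 1))))"

definition exp_dom :: "(complex \<times> complex) set" where
  "exp_dom = {(z, u). let \<alpha> = alpha u in
     exp (z * \<alpha>) * (\<alpha> - 1) + exp (- z * \<alpha>) * (\<alpha> + 1) \<noteq> 0}"

definition exp2_form :: "complex \<times> complex \<Rightarrow> complex" where
  "exp2_form = (\<lambda>(z, u). let \<alpha> = alpha u in
     u * ((exp (2 * z * \<alpha>) - 1) / (exp (2 * z * \<alpha>) * (\<alpha> - 1) + \<alpha> + 1)))"

definition exp2_dom :: "(complex \<times> complex) set" where
  "exp2_dom = {(z, u). let \<alpha> = alpha u in exp (2 * z * \<alpha>) * (\<alpha> - 1) + \<alpha> + 1 \<noteq> 0}"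

end

theory Submission
  imports Defs
begin

text \<open>
  No two white beads are ever adjacent, so in a necklace of size \<open>n\<close> with \<open>w\<close> white beads exactly
  \<open>2 * w\<close> gaps touch a white bead (\<open>card_gaps_next_to_white\<close>). An insertion there adds a black bead, an
  insertion elsewhere a white one. For the polynomials \<open>p\<^sub>n\<close> with coefficients \<open>P(W\<^sub>n = k)\<close> this gives
  the recurrence \<open>n * p\<^sub>n\<^sub>+\<^sub>1 = n * u * p\<^sub>n + 2 * u * (1 - u) * p\<^sub>n'\<close> (\<open>W_poly_Suc\<close>), or, for the generating
  function, the linear first-order partial differential equation
  \<open>(1 - u * z) * W\<^sub>z - 2 * u * (1 - u) * W\<^sub>u = u * (1 + W)\<close>.

  Instead of integrating this equation along characteristics, one can exploit that its left-hand
  side is a derivation applied to \<open>W\<close>. Applying this derivation to \<open>R = W\<^sub>z - u - 2 * W - W\<^sup>2\<close> yields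
  \<open>2 * u * R\<close>, and this forces \<open>R = 0\<close> as a formal power series (\<open>riccati_of_transport\<close>). The Riccati
  equation \<open>W\<^sub>z = u + 2 * W + W\<^sup>2\<close> has no \<open>u\<close>-derivative, so \<open>u\<close> becomes a mere parameter. With
  \<open>\<alpha>\<^sup>2 = 1 - u\<close> its solution starting at \<open>0\<close> satisfies
  \<open>W * (exp (z * \<alpha>) * (\<alpha> - 1) + exp (- z * \<alpha>) * (\<alpha> + 1)) = u * (exp (z * \<alpha>) - exp (- z * \<alpha>))\<close>
  (\<open>riccati_solution\<close>).

  Analytically, the coefficient of \<open>z ^ n\<close> belongs to necklaces of size \<open>n + 1\<close>, which have at most \<open>n\<close>
  white beads, so the \<open>z ^ n\<close> part of the double series is bounded by \<open>(norm z * (1 + norm u)) ^ n\<close>.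
  The series therefore converges absolutely, with a continuous sum, on the open set where
  \<open>norm z * (1 + norm u) < 1\<close>. There the common denominator above vanishes only for \<open>u = 1\<close>
  (\<open>denominator_nonzero\<close>), and \<open>sinh (z * \<alpha>)\<close> only for \<open>u = 1\<close> or \<open>z = 0\<close> (\<open>sinh_nonzero\<close>). Off these two
  lines the closed forms equal \<open>W\<close>. At a point of these lines where a closed form is undefined, the
  continuity of \<open>W\<close> says that \<open>W\<close> is its limit, so no limit has to be computed by hand.
\<close>

section \<open>White beads stay separated\<close>

definition separated_whites :: "bead list \<Rightarrow> bool" where
  "separated_whites xs \<longleftrightarrow>
     (\<forall>i<length xs. xs ! i = White \<longrightarrow> xs ! (Suc i mod length xs) = Black)"

lemma insert_bead_length: "i < length xs \<Longrightarrow> length (insert_bead xs i) = Suc (length xs)"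
  by (simp add: insert_bead_def)

lemma insert_bead_nth:
  assumes "i < length xs" "j \<le> length xs"
  shows "insert_bead xs i ! j =
    (if j \<le> i then xs ! j
     else if j = Suc i then new_bead (xs ! i) (xs ! (Suc i mod length xs))
     else xs ! (j - 1))"
  using assms by (auto simp: insert_bead_def nth_append min_def nth_Cons' intro!: arg_cong[of _ _ "(!) xs"])

lemma new_bead_eq_White_iff: "new_bead a b = White \<longleftrightarrow> a \<noteq> White \<and> b \<noteq> White"
  by (cases a; cases b) (auto simp: new_bead_def)

lemma white_beads_insert_bead:
  assumes "i < length xs"
  shows "white_beads (insert_bead xs i) =
    (if xs ! i = White \<or> xs ! (Suc i mod length xs) = White then white_beads xs
     else Suc (white_beads xs))"
proof -
  have "count_list xs White = count_list (take (Suc i) xs) White + count_list (drop (Suc i) xs) White"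
    by (metis append_take_drop_id count_list_append)
  then show ?thesis
    by (simp add: white_beads_def insert_bead_def new_bead_eq_White_iff)
qed

text \<open>
  A white bead is only ever inserted between two black ones, and inserting a black bead cannot
  bring two white beads together. In the proof, position \<open>j\<close> of the new necklace comes from
  position \<open>j\<close> or \<open>j - 1\<close> of the old one according to the side of the new bead on which it lies;
  the successor of the last position is position \<open>0\<close>, which no insertion moves.
\<close>

lemma separated_whites_insert_bead:
  assumes sep: "separated_whites xs" and i: "i < length xs"
  shows "separated_whites (insert_bead xs i)"
  unfolding separated_whites_def
proof (intro allI impI)
  fix j assume "j < length (insert_bead xs i)" and white: "insert_bead xs i ! j = White"
  then have j: "j \<le> length xs" by (simp add: insert_bead_length[OF i])
  have next_j: "Suc j mod length (insert_bead xs i) = (if j = length xs then 0 else Suc j)"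
    using j by (simp add: insert_bead_length[OF i])
  have nth_0: "insert_bead xs i ! 0 = xs ! 0"
    using i by (simp add: insert_bead_nth)
  have sepD: "xs ! k = White \<Longrightarrow> k < length xs \<Longrightarrow> xs ! (Suc k mod length xs) \<noteq> White" for k
    using sep by (auto simp: separated_whites_def)
  have next_nth: "insert_bead xs i ! Suc j = xs ! (j)" if "Suc i \<le> j" "j < length xs"
    using that i by (simp add: insert_bead_nth)
  consider "j < i" | "j = i" | "j = Suc i" | "j > Suc i" by linarith
  then have "insert_bead xs i ! (Suc j mod length (insert_bead xs i)) \<noteq> White"
  proof cases
    case 1
    then show ?thesis
      using white i sepD[of j] by (auto simp: next_j insert_bead_nth)
  next
    case 2
    then show ?thesis
      unfolding next_j using white i by (auto simp: insert_bead_nth new_bead_eq_White_iff)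
  next
    case 3
    then have "xs ! (Suc i mod length xs) \<noteq> White"
      using white i by (auto simp: insert_bead_nth new_bead_eq_White_iff)
    moreover have "insert_bead xs i ! (Suc j mod length (insert_bead xs i)) = xs ! (Suc i mod length xs)"
      unfolding next_j using 3 i nth_0 next_nth j by (cases "Suc i = length xs") auto
    ultimately show ?thesis by simp
  next
    case 4
    then have "xs ! (j - 1) = White"
      using white i j by (simp add: insert_bead_nth)
    with sepD[of "j - 1"] 4 j have "xs ! (j mod length xs) \<noteq> White" by simp
    moreover have "insert_bead xs i ! (Suc j mod length (insert_bead xs i)) = xs ! (j mod length xs)"
      using 4 i nth_0 next_nth j by (auto simp: next_j)
    ultimately show ?thesis by simp
  qed
  then show "insert_bead xs i ! (Suc j mod length (insert_bead xs i)) = Black"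
    by (meson bead.exhaust)
qed

lemma card_white_positions: "card {i. i < length xs \<and> xs ! i = White} = white_beads xs"
  by (simp add: white_beads_def count_list_eq_length_filter length_filter_conv_card eq_commute)

lemma bij_betw_cyclic_Suc:
  assumes "n > 0"
  shows "bij_betw (\<lambda>i. Suc i mod n) {..<n} {..<n}"
proof -
  have "inj_on (\<lambda>i. Suc i mod n) {..<n}"
    by (auto simp: inj_on_def mod_Suc split: if_splits)
  moreover have "(\<lambda>i. Suc i mod n) ` {..<n} \<subseteq> {..<n}"
    using assms by auto
  ultimately show ?thesis
    by (simp add: bij_betw_def endo_inj_surj)
qed

text \<open>
  Every white bead touches two gaps, and separation prevents two white beads from sharing one.
  This is what makes the number of white beads a Markov chain: of the \<open>n\<close> gaps of a necklace with
  \<open>w\<close> white beads, exactly \<open>2 * w\<close> receive a black bead.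
\<close>

lemma card_gaps_next_to_white:
  assumes sep: "separated_whites xs" and ne: "xs \<noteq> []"
  shows "card {i. i < length xs \<and> (xs ! i = White \<or> xs ! (Suc i mod length xs) = White)}
           = 2 * white_beads xs"
proof -
  let ?n = "length xs"
  let ?A = "{i. i < ?n \<and> xs ! i = White}"
  let ?B = "{i. i < ?n \<and> xs ! (Suc i mod ?n) = White}"
  have bij: "bij_betw (\<lambda>i. Suc i mod ?n) {..<?n} {..<?n}"
    using ne by (intro bij_betw_cyclic_Suc) simp
  have "bij_betw (\<lambda>i. Suc i mod ?n) ?B ?A"
  proof (rule bij_betw_subset[OF bij])
    show "?B \<subseteq> {..<?n}" by auto
    show "(\<lambda>i. Suc i mod ?n) ` ?B = ?A"
    proof
      show "?A \<subseteq> (\<lambda>i. Suc i mod ?n) ` ?B"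
      proof
        fix j assume j: "j \<in> ?A"
        then have "j \<in> (\<lambda>i. Suc i mod ?n) ` {..<?n}"
          using bij by (auto simp: bij_betw_def)
        with j show "j \<in> (\<lambda>i. Suc i mod ?n) ` ?B" by auto
      qed
    qed (use ne in auto)
  qed
  then have "card ?B = card ?A" by (rule bij_betw_same_card)
  moreover have "?A \<inter> ?B = {}"
    using sep by (auto simp: separated_whites_def)
  moreover have "{i. i < ?n \<and> (xs ! i = White \<or> xs ! (Suc i mod ?n) = White)} = ?A \<union> ?B"
    by auto
  ultimately show ?thesis
    using card_Un_disjoint[of ?A ?B] by (simp add: card_white_positions)
qed

lemma set_pmf_necklace_process:
  "xs \<in> set_pmf (necklace_process m) \<Longrightarrow>
     separated_whites xs \<and> length xs = m + 2 \<and> 1 \<le> white_beads xs \<and> white_beads xs \<le> m + 1"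
proof (induction m arbitrary: xs)
  case 0
  then show ?case
    by (auto simp: separated_whites_def white_beads_def less_Suc_eq)
next
  case (Suc m)
  then obtain ys where ys: "ys \<in> set_pmf (necklace_process m)"
    and xs: "xs \<in> insert_bead ys ` set_pmf (pmf_of_set {..<length ys})"
    by auto
  note IH = Suc.IH[OF ys]
  have "{..<length ys} \<noteq> {}" using IH by auto
  then obtain i where "i < length ys" "xs = insert_bead ys i"
    using xs by (auto simp: set_pmf_of_set)
  then show ?case
    using IH by (auto simp: separated_whites_insert_bead insert_bead_length white_beads_insert_bead)
qed

section \<open>The recurrence for the number of white beads\<close>

definition white_prob :: "nat \<Rightarrow> nat \<Rightarrow> real" where
  "white_prob m k = pmf (map_pmf white_beads (necklace_process m)) k"

lemma white_prob_0: "white_prob 0 k = (if k = 1 then 1 else 0)"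
  by (simp add: white_prob_def white_beads_def indicator_def)

lemma white_prob_eq_0:
  assumes "k = 0 \<or> k > m + 1"
  shows "white_prob m k = 0"
  using assms set_pmf_necklace_process[of _ m]
  by (force simp: white_prob_def pmf_eq_0_set_pmf)

lemma pmf_white_beads_insert:
  assumes sep: "separated_whites xs" and ne: "xs \<noteq> []"
  shows "real (length xs) * pmf (map_pmf (white_beads \<circ> insert_bead xs) (pmf_of_set {..<length xs})) k
    = 2 * real k * of_bool (white_beads xs = k)
      + (real (length xs) + 2 - 2 * real k) * of_bool (Suc (white_beads xs) = k)"
proof -
  let ?n = "length xs" and ?w = "white_beads xs"
  let ?A = "{i. i < ?n \<and> (xs ! i = White \<or> xs ! (Suc i mod ?n) = White)}"
  have cardA: "card ?A = 2 * ?w" by (rule card_gaps_next_to_white[OF sep ne])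
  have A: "?A \<subseteq> {..<?n}" by auto
  have le: "2 * ?w \<le> ?n" using card_mono[OF _ A] cardA by simp
  have white_iff: "white_beads (insert_bead xs i) = k \<longleftrightarrow> (if i \<in> ?A then k = ?w else k = Suc ?w)"
    if "i < ?n" for i k
    using that by (auto simp: white_beads_insert_bead)
  have "{..<?n} \<inter> (white_beads \<circ> insert_bead xs) -` {k} =
      (if k = ?w then ?A else if k = Suc ?w then {..<?n} - ?A else {})"
    by (auto simp: white_iff split: if_splits)
  then have "card ({..<?n} \<inter> (white_beads \<circ> insert_bead xs) -` {k}) =
      (if k = ?w then 2 * ?w else if k = Suc ?w then ?n - 2 * ?w else 0)"
    using A by (simp add: cardA card_Diff_subset finite_subset[OF A])
  moreover have "{..<?n} \<noteq> {}" using ne by auto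
  ultimately show ?thesis
    using le ne by (auto simp: pmf_map measure_pmf_of_set)
qed

text \<open>
  To reach \<open>k\<close> white beads, either there were \<open>k\<close> of them and one of the \<open>2 * k\<close> gaps next to a white
  bead was chosen, or there were \<open>k - 1\<close> and one of the other \<open>m + 2 - 2 * (k - 1)\<close> gaps was. The factor \<open>m + 2\<close> is
  the number of all gaps.
\<close>

lemma white_prob_Suc:
  "(real m + 2) * white_prob (Suc m) k =
     2 * real k * white_prob m k
     + (if k = 0 then 0 else (real m + 4 - 2 * real k) * white_prob m (k - 1))"
proof -
  let ?M = "necklace_process m"
  let ?E = "measure_pmf.expectation ?M"
  have int [simp]: "integrable (measure_pmf ?M) (\<lambda>xs. of_bool (P xs) :: real)" for P
    by (rule measure_pmf.integrable_const_bound[where B = 1]) auto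
  have expectation: "?E (\<lambda>xs. of_bool (white_beads xs = j)) = white_prob m j" for j
  proof -
    have "?E (\<lambda>xs. of_bool (white_beads xs = j)) = ?E (indicator (white_beads -` {j}))"
      by (intro arg_cong[of _ _ ?E]) (auto simp: indicator_def)
    also have "\<dots> = white_prob m j"
      by (simp add: white_prob_def pmf_map del: vimage_singleton_eq)
    finally show ?thesis .
  qed
  have expectation_Suc: "?E (\<lambda>xs. of_bool (Suc (white_beads xs) = k)) =
      (if k = 0 then 0 else white_prob m (k - 1))"
    using expectation[of "k - 1"] by (cases k) auto
  have "(real m + 2) * white_prob (Suc m) k =
      ?E (\<lambda>xs. (real m + 2) * pmf (map_pmf (white_beads \<circ> insert_bead xs) (pmf_of_set {..<length xs})) k)"
    by (simp add: white_prob_def map_bind_pmf pmf_bind map_pmf_comp comp_def)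
  also have "\<dots> = ?E (\<lambda>xs. 2 * real k * of_bool (white_beads xs = k)
      + (real m + 4 - 2 * real k) * of_bool (Suc (white_beads xs) = k))"
  proof (intro integral_cong_AE)
    show "AE xs in ?M.
      (real m + 2) * pmf (map_pmf (white_beads \<circ> insert_bead xs) (pmf_of_set {..<length xs})) k =
      2 * real k * of_bool (white_beads xs = k)
      + (real m + 4 - 2 * real k) * of_bool (Suc (white_beads xs) = k)"
    proof (rule AE_pmfI)
      fix xs assume "xs \<in> set_pmf ?M"
      then have "separated_whites xs" "length xs = m + 2"
        using set_pmf_necklace_process by blast+
      then show "(real m + 2) * pmf (map_pmf (white_beads \<circ> insert_bead xs) (pmf_of_set {..<length xs})) k =
          2 * real k * of_bool (white_beads xs = k)
          + (real m + 4 - 2 * real k) * of_bool (Suc (white_beads xs) = k)"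
        using pmf_white_beads_insert[of xs k] by (cases "xs = []") (simp_all add: add_ac)
    qed
  qed auto
  also have "\<dots> = 2 * real k * white_prob m k
     + (if k = 0 then 0 else (real m + 4 - 2 * real k) * white_prob m (k - 1))"
    by (simp add: expectation expectation_Suc)
  finally show ?thesis .
qed

section \<open>From the transport equation to the Riccati equation\<close>

unbundle no vec_syntax
unbundle fps_syntax

text \<open>
  A bivariate series in \<open>z\<close> and \<open>u\<close> that is polynomial in \<open>u\<close> at each power of \<open>z\<close> is a formal power
  series over the polynomials. Then \<open>fps_deriv\<close> is \<open>\<partial>/\<partial>z\<close>, \<open>fps_coeff_deriv\<close> is \<open>\<partial>/\<partial>u\<close>, and \<open>fps_U\<close> is the
  variable \<open>u\<close>.
\<close>

definition fps_coeff_deriv :: "complex poly fps \<Rightarrow> complex poly fps" where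
  "fps_coeff_deriv F = Abs_fps (\<lambda>n. pderiv (F $ n))"

lemma fps_coeff_deriv_nth [simp]: "fps_coeff_deriv F $ n = pderiv (F $ n)"
  by (simp add: fps_coeff_deriv_def)

lemma pderiv_sum: "pderiv (sum f A) = (\<Sum>x\<in>A. pderiv (f x))"
  using higher_pderiv_sum[of 1] by simp

lemma fps_coeff_deriv_mult:
  "fps_coeff_deriv (F * G) = F * fps_coeff_deriv G + fps_coeff_deriv F * G"
proof (rule fps_ext)
  have "pderiv (p * q) = p * pderiv q + pderiv p * q" for p q :: "complex poly"
    by (simp add: pderiv_mult mult.commute)
  then show "fps_coeff_deriv (F * G) $ n = (F * fps_coeff_deriv G + fps_coeff_deriv F * G) $ n" for n
    by (simp add: fps_mult_nth pderiv_sum sum.distrib)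
qed

lemma fps_coeff_deriv_add: "fps_coeff_deriv (F + G) = fps_coeff_deriv F + fps_coeff_deriv G"
  by (rule fps_ext) (simp add: pderiv_add)

lemma fps_coeff_deriv_diff: "fps_coeff_deriv (F - G) = fps_coeff_deriv F - fps_coeff_deriv G"
  by (rule fps_ext) (simp add: pderiv_diff)

lemma fps_coeff_deriv_fps_deriv:
  "fps_coeff_deriv (fps_deriv F) = fps_deriv (fps_coeff_deriv F)"
  by (rule fps_ext) (simp add: pderiv_mult pderiv_smult of_nat_poly flip: of_nat_Suc)

lemma fps_coeff_deriv_const: "fps_coeff_deriv (fps_const p) = fps_const (pderiv p)"
  by (rule fps_ext) simp

abbreviation fps_U :: "complex poly fps" where
  "fps_U \<equiv> fps_const [:0, 1:]"

text \<open>
  The vector field \<open>D = (1 - u * z) * \<partial>/\<partial>z - 2 * u * (1 - u) * \<partial>/\<partial>u\<close>. It is chosen so that the recurrence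
  for the polynomials of the process is the equation \<open>D G = u * (1 + G)\<close> for their generating
  function \<open>G\<close>. Being a derivation, it can be applied to the Riccati equation term by term.
\<close>

definition transport :: "complex poly fps \<Rightarrow> complex poly fps" where
  "transport F = (1 - fps_U * fps_X) * fps_deriv F - 2 * fps_U * (1 - fps_U) * fps_coeff_deriv F"

lemma transport_add: "transport (F + G) = transport F + transport G"
  by (simp add: transport_def fps_coeff_deriv_add algebra_simps)

lemma transport_diff: "transport (F - G) = transport F - transport G"
  by (simp add: transport_def fps_coeff_deriv_diff algebra_simps)

lemma transport_mult: "transport (F * G) = F * transport G + transport F * G"
  by (simp add: transport_def fps_coeff_deriv_mult algebra_simps)

lemma transport_fps_U: "transport fps_U = - 2 * fps_U * (1 - fps_U)"
  by (simp add: transport_def fps_coeff_deriv_const pderiv_pCons)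

text \<open>
  The coefficient \<open>1 - u * z\<close> depends on \<open>z\<close>, so \<open>D\<close> does not commute with \<open>\<partial>/\<partial>z\<close>; the commutator
  is \<open>u * \<partial>/\<partial>z\<close>.
\<close>

lemma transport_fps_deriv:
  "transport (fps_deriv F) = fps_deriv (transport F) + fps_U * fps_deriv F"
  by (simp add: transport_def fps_coeff_deriv_fps_deriv algebra_simps)

lemma transport_nth:
  "transport F $ n = of_nat (Suc n) * F $ Suc n - of_nat n * ([:0, 1:] * F $ n)
     - 2 * [:0, 1:] * (1 - [:0, 1:]) * pderiv (F $ n)"
proof -
  have "2 * fps_U * (1 - fps_U) = fps_const (2 * [:0, 1:] * (1 - [:0, 1:]))"
    by (simp only: numeral_fps_const fps_const_mult fps_const_sub flip: fps_const_1_eq_1)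
  then have "transport F = fps_deriv F - fps_U * (fps_X * fps_deriv F)
      - fps_const (2 * [:0, 1:] * (1 - [:0, 1:])) * fps_coeff_deriv F"
    by (simp only: transport_def left_diff_distrib mult_1_left mult.assoc)
  then show ?thesis
    by (simp only: fps_mult_fps_X_deriv_shift fps_sub_nth fps_mult_left_const_nth fps_deriv_nth
        fps_coeff_deriv_nth fps_nth_Abs_fps Suc_eq_plus1 mult.left_commute)
qed

text \<open>
  At \<open>z ^ n\<close> the equation expresses \<open>n + 1\<close> times the next coefficient by the current one and its
  \<open>u\<close>-derivative, so a vanishing constant term propagates.
\<close>

lemma transport_eigen_unique:
  assumes eigen: "transport R = 2 * fps_U * R" and R0: "R $ 0 = 0"
  shows "R = 0"
proof -
  have "R $ n = 0" for n
  proof (induction n)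
    case (Suc n)
    have "2 * fps_U * R = fps_const (2 * [:0, 1:]) * R"
      by (simp only: numeral_fps_const fps_const_mult)
    then have "transport R $ n = 2 * [:0, 1:] * R $ n"
      by (simp only: eigen fps_mult_left_const_nth)
    with Suc show ?case
      by (simp add: transport_nth del: of_nat_Suc)
  qed (use R0 in simp)
  then show ?thesis by (simp add: fps_eq_iff)
qed

text \<open>
  The defect \<open>R = G' - u - 2 * G - G\<^sup>2\<close> of the Riccati equation is an eigenvector of the derivation:
  from \<open>D G = u * (1 + G)\<close> one gets \<open>D G' = 2 * u * G'\<close>, and \<open>D u = - 2 * u * (1 - u)\<close>, whence
  \<open>D R = 2 * u * (G' + 1 - u - (1 + G)\<^sup>2) = 2 * u * R\<close>. Its constant term is \<open>0\<close>, so \<open>R = 0\<close>.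
\<close>

lemma riccati_of_transport:
  assumes G: "transport G = fps_U * (1 + G)" and G0: "G $ 0 = 0" and G1: "G $ 1 = [:0, 1:]"
  shows "fps_deriv G = fps_U + 2 * G + G * G"
proof -
  \<comment> \<open>\<open>G + G\<close> instead of \<open>2 * G\<close>, so that additivity of the derivation is enough for this term.\<close>
  define R where "R = fps_deriv G - fps_U - (G + G) - G * G"
  have "transport R = transport (fps_deriv G) - transport fps_U
      - (transport G + transport G) - (G * transport G + transport G * G)"
    unfolding R_def transport_diff transport_add transport_mult ..
  also have "transport (fps_deriv G) = 2 * fps_U * fps_deriv G"
    unfolding transport_fps_deriv G by (simp add: algebra_simps)
  also have "2 * fps_U * fps_deriv G - transport fps_U
      - (transport G + transport G) - (G * transport G + transport G * G) = 2 * fps_U * R"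
    unfolding G transport_fps_U R_def by algebra
  finally have "R = 0"
    by (rule transport_eigen_unique) (simp add: R_def G0 G1[simplified])
  then show ?thesis by (simp add: R_def algebra_simps)
qed

section \<open>Solving the Riccati equation\<close>

lemma fps_linear_ODE_zero:
  fixes H A :: "'a::{idom, ring_char_0} fps"
  assumes "fps_deriv H = A * H" and "H $ 0 = 0"
  shows "H = 0"
proof -
  have "H $ n = 0" for n
  proof (induction n rule: less_induct)
    case (less n)
    show ?case
    proof (cases n)
      case (Suc m)
      have "of_nat n * H $ n = (A * H) $ m"
        using arg_cong[OF assms(1), of "\<lambda>f. f $ m"] by (simp add: Suc)
      also have "\<dots> = 0"
        using less.IH by (auto simp: fps_mult_nth Suc intro!: sum.neutral)
      finally show ?thesis by (simp add: Suc del: of_nat_Suc)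
    qed (use assms in simp)
  qed
  then show ?thesis by (simp add: fps_eq_iff)
qed

text \<open>
  The Riccati equation turns into the linear equation \<open>H' = (1 + F) * H\<close> for the difference \<open>H\<close> of the
  two sides, and \<open>H\<close> starts at \<open>0\<close>. Working with the identity cleared of its denominator avoids
  division by power series and keeps it valid, though trivial, at \<open>\<alpha> = 0\<close>.
\<close>

lemma riccati_solution:
  fixes F :: "'a::field_char_0 fps"
  assumes F: "fps_deriv F = fps_const u + 2 * F + F * F" and F0: "F $ 0 = 0"
    and \<alpha>: "\<alpha>\<^sup>2 = 1 - u"
  shows "F * (fps_const (\<alpha> - 1) * fps_exp \<alpha> + fps_const (\<alpha> + 1) * fps_exp (- \<alpha>))
    = fps_const u * (fps_exp \<alpha> - fps_exp (- \<alpha>))"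
proof -
  define a where "a = fps_const \<alpha>"
  define P where "P = fps_exp \<alpha>"
  define Q where "Q = fps_exp (- \<alpha>)"
  define H where "H = F * ((a - 1) * P + (a + 1) * Q) - (1 - a * a) * (P - Q)"
  have u: "fps_const u = 1 - a * a"
    using \<alpha> by (simp add: a_def power2_eq_square)
  have P: "fps_deriv P = a * P" and Q: "fps_deriv Q = - a * Q" and a: "fps_deriv a = 0"
    by (simp_all add: P_def Q_def a_def)
  have "fps_deriv H = (1 + F) * H"
    unfolding H_def by (simp add: F u P Q a) algebra
  moreover have "H $ 0 = 0"
    by (simp add: H_def F0 P_def Q_def)
  ultimately have "H = 0" by (rule fps_linear_ODE_zero)
  then show ?thesis
    unfolding u H_def P_def Q_def a_def
    by (simp flip: fps_const_sub fps_const_add)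
qed

section \<open>The generating function of the necklace process\<close>

definition W_poly :: "nat \<Rightarrow> complex poly" where
  "W_poly m = (\<Sum>k\<le>m + 1. monom (of_real (white_prob m k)) k)"

lemma coeff_W_poly [simp]: "coeff (W_poly m) k = of_real (white_prob m k)"
  using white_prob_eq_0[of k m] by (auto simp: W_poly_def coeff_sum sum.delta)

lemma poly_W_poly: "poly (W_poly m) u = (\<Sum>k\<le>m + 1. of_real (white_prob m k) * u ^ k)"
  by (simp add: W_poly_def poly_sum poly_monom)

lemma W_poly_0: "W_poly 0 = [:0, 1:]"
  by (rule poly_eqI) (simp add: white_prob_0 coeff_pCons split: nat.splits)

lemma W_poly_Suc:
  "of_nat (m + 2) * W_poly (Suc m) =
     [:0, 1:] * (of_nat (m + 2) * W_poly m + 2 * (1 - [:0, 1:]) * pderiv (W_poly m))"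
proof (rule poly_eqI)
  fix k
  have rec: "complex_of_real ((real m + 2) * white_prob (Suc m) k) =
      of_real (2 * real k * white_prob m k
        + (if k = 0 then 0 else (real m + 4 - 2 * real k) * white_prob m (k - 1)))"
    by (simp only: white_prob_Suc)
  show "coeff (of_nat (m + 2) * W_poly (Suc m)) k =
    coeff ([:0, 1:] * (of_nat (m + 2) * W_poly m + 2 * (1 - [:0, 1:]) * pderiv (W_poly m))) k"
  proof (cases k)
    case 0
    then show ?thesis
      using rec by (simp add: of_nat_poly add.commute)
  next
    case (Suc j)
    then show ?thesis
      using rec
      by (cases j) (simp_all add: of_nat_poly coeff_pderiv algebra_simps numeral_poly)
  qed
qed

text \<open>
  The power of \<open>z\<close> is the size minus one, and the process starts at size \<open>2\<close>; hence the shift by one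
  between the exponent of \<open>z\<close> and the number of insertions, and the zero constant term.
\<close>

definition W_fps :: "complex poly fps" where
  "W_fps = Abs_fps (\<lambda>n. case n of 0 \<Rightarrow> 0 | Suc m \<Rightarrow> W_poly m)"

lemma W_fps_nth [simp]: "W_fps $ 0 = 0" "W_fps $ Suc m = W_poly m"
  by (simp_all add: W_fps_def)

lemma transport_W_fps: "transport W_fps = fps_U * (1 + W_fps)"
proof (rule fps_ext)
  fix n
  have rhs: "(fps_U * (1 + W_fps)) $ n = [:0, 1:] * ((if n = 0 then 1 else 0) + W_fps $ n)"
    by (simp only: fps_add_nth fps_mult_left_const_nth fps_one_nth)
  show "transport W_fps $ n = (fps_U * (1 + W_fps)) $ n"
  proof (cases n)
    case 0
    then show ?thesis unfolding rhs transport_nth by (simp add: W_poly_0)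
  next
    case (Suc m)
    have lhs: "transport W_fps $ n = of_nat (m + 2) * W_poly (Suc m)
        - of_nat (m + 1) * ([:0, 1:] * W_poly m)
        - 2 * [:0, 1:] * (1 - [:0, 1:]) * pderiv (W_poly m)"
      by (simp only: Suc transport_nth W_fps_nth) simp
    have rhs: "(fps_U * (1 + W_fps)) $ n = [:0, 1:] * W_poly m"
      unfolding rhs by (simp add: Suc)
    show ?thesis
      using W_poly_Suc[of m] unfolding lhs rhs of_nat_add of_nat_1 of_nat_numeral
      by algebra
  qed
qed

lemma W_fps_riccati: "fps_deriv W_fps = fps_U + 2 * W_fps + W_fps * W_fps"
  by (rule riccati_of_transport[OF transport_W_fps]) (simp_all add: W_poly_0)

definition W_series :: "complex \<Rightarrow> complex fps" where
  "W_series u = Abs_fps (\<lambda>n. poly (W_fps $ n) u)"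

lemma W_series_nth [simp]: "W_series u $ n = poly (W_fps $ n) u"
  by (simp add: W_series_def)

text \<open>
  Evaluation at \<open>u\<close> is a ring homomorphism, and the bivariate equation has no derivative in \<open>u\<close>, so
  it specialises to an ordinary differential equation for each \<open>u\<close>.
\<close>

lemma W_series_riccati:
  "fps_deriv (W_series u) = fps_const u + 2 * W_series u + W_series u * W_series u"
proof (rule fps_ext)
  fix n
  have double_nth: "(2 * F) $ n = 2 * F $ n" for F :: "'a::comm_ring_1 fps"
    by (simp only: numeral_fps_const fps_mult_left_const_nth)
  have "poly (fps_deriv W_fps $ n) u = poly ((fps_U + 2 * W_fps + W_fps * W_fps) $ n) u"
    by (simp only: W_fps_riccati)
  then show "fps_deriv (W_series u) $ n =
      (fps_const u + 2 * W_series u + W_series u * W_series u) $ n"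
    unfolding fps_add_nth double_nth by (simp add: fps_mult_nth poly_sum)
qed

lemma W_series_closed_form:
  assumes "\<alpha>\<^sup>2 = 1 - u"
  shows "W_series u * (fps_const (\<alpha> - 1) * fps_exp \<alpha> + fps_const (\<alpha> + 1) * fps_exp (- \<alpha>))
    = fps_const u * (fps_exp \<alpha> - fps_exp (- \<alpha>))"
  by (rule riccati_solution[OF W_series_riccati _ assms]) simp

section \<open>Convergence\<close>

text \<open>
  The left-hand side is the expectation of \<open>x\<close> to the number of white beads, which is at most
  \<open>m + 1\<close>; replacing \<open>x\<close> by \<open>1 + x \<ge> 1\<close> makes the powers increasing.
\<close>

lemma sum_white_prob_le:
  assumes "0 \<le> x"
  shows "(\<Sum>k\<le>m + 1. white_prob m k * x ^ k) \<le> (1 + x) ^ (m + 1)"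
proof -
  have "(\<Sum>k\<le>m + 1. white_prob m k * x ^ k) \<le> (\<Sum>k\<le>m + 1. white_prob m k * (1 + x) ^ (m + 1))"
  proof (rule sum_mono)
    fix k assume k: "k \<in> {..m + 1}"
    have "x ^ k \<le> (1 + x) ^ k" using assms by (intro power_mono) auto
    also have "\<dots> \<le> (1 + x) ^ (m + 1)" using assms k by (intro power_increasing) auto
    finally show "white_prob m k * x ^ k \<le> white_prob m k * (1 + x) ^ (m + 1)"
      by (intro mult_left_mono) (auto simp: white_prob_def)
  qed
  also have "\<dots> = (\<Sum>k\<le>m + 1. white_prob m k) * (1 + x) ^ (m + 1)"
    by (rule sum_distrib_right[symmetric])
  also have "(\<Sum>k\<le>m + 1. white_prob m k) = 1"
    unfolding white_prob_def
    using set_pmf_necklace_process[of _ m] by (intro sum_pmf_eq_1) auto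
  finally show ?thesis by simp
qed

lemma norm_W_fps_coeff_le:
  "norm (poly (W_fps $ n) u * z ^ n) \<le> (norm z * (1 + norm u)) ^ n"
proof (cases n)
  case (Suc m)
  have "norm (poly (W_poly m) u) \<le> (\<Sum>k\<le>m + 1. norm (of_real (white_prob m k) * u ^ k))"
    unfolding poly_W_poly by (rule norm_sum)
  also have "\<dots> = (\<Sum>k\<le>m + 1. white_prob m k * norm u ^ k)"
    by (simp add: norm_mult norm_power white_prob_def)
  also have "\<dots> \<le> (1 + norm u) ^ n"
    using sum_white_prob_le[of "norm u" m] Suc by simp
  finally have "norm (poly (W_poly m) u) * norm z ^ n \<le> (1 + norm u) ^ n * norm z ^ n"
    by (intro mult_right_mono) auto
  then show ?thesis
    by (simp add: Suc norm_mult norm_power power_mult_distrib mult_ac)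
qed simp

lemma W_term_eq: "2 \<le> n \<Longrightarrow> W_term z u (n, k) = of_real (white_prob (n - 2) k) * z ^ (n - 1) * u ^ k"
  by (simp add: W_term_def white_prob_def random_necklace_def pmf_map vimage_def)

context
  fixes z u :: complex
  assumes small: "norm z * (1 + norm u) < 1"
begin

text \<open>
  Only finitely many numbers of white beads are possible for a given size \<open>n\<close>, so each row of the
  double series is a finite sum; starting at \<open>k = 1\<close> loses nothing, since there is always a white bead.
\<close>

lemma has_sum_row:
  assumes "2 \<le> n"
  shows "((\<lambda>k. W_term z u (n, k)) has_sum poly (W_fps $ (n - 1)) u * z ^ (n - 1)) {1..}"
proof -
  obtain m where n: "n = m + 2" using assms by (metis add.commute le_Suc_ex)
  have "((\<lambda>k. W_term z u (n, k)) has_sum (\<Sum>k\<le>m + 1. W_term z u (n, k))) {..m + 1}"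
    by (rule has_sum_finite) simp
  also have "?this \<longleftrightarrow> ((\<lambda>k. W_term z u (n, k)) has_sum (\<Sum>k\<le>m + 1. W_term z u (n, k))) {1..}"
    by (rule has_sum_cong_neutral) (auto simp: W_term_eq n white_prob_eq_0)
  also have "(\<Sum>k\<le>m + 1. W_term z u (n, k)) = poly (W_fps $ (n - 1)) u * z ^ (n - 1)"
    by (simp add: n W_term_eq poly_W_poly sum_distrib_left sum_distrib_right mult_ac del: sum.atMost_Suc)
  finally show ?thesis .
qed

lemma has_sum_row_norm:
  assumes "2 \<le> n"
  shows "\<exists>s. ((\<lambda>k. norm (W_term z u (n, k))) has_sum s) {1..} \<and> 0 \<le> s
    \<and> s \<le> (norm z * (1 + norm u)) ^ (n - 1)"
proof -
  obtain m where n: "n = m + 2" using assms by (metis add.commute le_Suc_ex)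
  let ?s = "\<Sum>k\<le>m + 1. norm (W_term z u (n, k))"
  have "((\<lambda>k. norm (W_term z u (n, k))) has_sum ?s) {..m + 1}"
    by (rule has_sum_finite) simp
  also have "?this \<longleftrightarrow> ((\<lambda>k. norm (W_term z u (n, k))) has_sum ?s) {1..}"
    by (rule has_sum_cong_neutral) (auto simp: W_term_eq n white_prob_eq_0)
  finally have "((\<lambda>k. norm (W_term z u (n, k))) has_sum ?s) {1..}" .
  moreover have "?s = norm z ^ (m + 1) * (\<Sum>k\<le>m + 1. white_prob m k * norm u ^ k)"
    by (simp add: n W_term_eq norm_mult norm_power white_prob_def sum_distrib_left mult_ac
        del: sum.atMost_Suc)
  then have "?s \<le> norm z ^ (m + 1) * (1 + norm u) ^ (m + 1)"
    using sum_white_prob_le[of "norm u" m] by (simp add: mult_left_mono del: sum.atMost_Suc power_Suc)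
  ultimately show ?thesis
    by (intro exI[of _ ?s])
      (simp add: n power_mult_distrib sum_nonneg del: sum.atMost_Suc power_Suc)
qed

lemma W_term_summable: "W_term z u summable_on W_index"
proof -
  let ?r = "norm z * (1 + norm u)"
  have r: "summable (\<lambda>n. norm (?r ^ n))"
    using small by (simp add: norm_power abs_mult)
  then have "(\<lambda>n. ?r ^ n) summable_on UNIV"
    by (rule norm_summable_imp_summable_on)
  then have "(\<lambda>n. ?r ^ n) summable_on {1..}"
    by (rule summable_on_subset_banach) simp
  also have "?this \<longleftrightarrow> (\<lambda>n. ?r ^ (n - 1)) summable_on {2..}"
    by (rule summable_on_reindex_bij_witness[of _ "\<lambda>n. n - 1" Suc]) auto
  finally have geo: "(\<lambda>n. ?r ^ (n - 1)) summable_on {2..}" .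
  have "(\<lambda>p. norm (W_term z u p)) summable_on W_index"
    unfolding W_index_def Infinite_Sum.abs_summable_on_Sigma_iff
  proof (intro conjI ballI)
    fix n :: nat assume "n \<in> {2..}"
    then show "(\<lambda>k. norm (W_term z u (n, k))) summable_on {1..}"
      using has_sum_row_norm[of n] by (auto simp: summable_on_def)
  next
    show "(\<lambda>n. norm (infsum (\<lambda>k. norm (W_term z u (n, k))) {1..})) summable_on {2..}"
    proof (rule Infinite_Sum.abs_summable_on_comparison_test')
      show "(\<lambda>n. ?r ^ (n - 1)) summable_on {2..}" by (rule geo)
      fix n :: nat assume "n \<in> {2..}"
      then show "norm (infsum (\<lambda>k. norm (W_term z u (n, k))) {1..}) \<le> ?r ^ (n - 1)"
        using has_sum_row_norm[of n] by (auto simp: infsumI)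
    qed
  qed
  then show ?thesis by (rule abs_summable_summable)
qed

lemma W_eq_eval_fps: "W z u = eval_fps (W_series u) z"
proof -
  have "(W_term z u has_sum W z u) ({2..} \<times> {1..})"
    using W_term_summable by (simp add: W_def W_index_def has_sum_infsum)
  then have "((\<lambda>n. poly (W_fps $ (n - 1)) u * z ^ (n - 1)) has_sum W z u) {2..}"
    by (rule has_sum_SigmaD) (use has_sum_row in auto)
  also have "?this \<longleftrightarrow> ((\<lambda>n. poly (W_fps $ n) u * z ^ n) has_sum W z u) {1..}"
    by (rule has_sum_reindex_bij_witness[of _ Suc "\<lambda>n. n - 1"]) auto
  also have "\<dots> \<longleftrightarrow> ((\<lambda>n. poly (W_fps $ n) u * z ^ n) has_sum W z u) UNIV"
    by (rule has_sum_cong_neutral) (auto simp: not_le)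
  finally have "(\<lambda>n. poly (W_fps $ n) u * z ^ n) sums W z u"
    by (rule has_sum_imp_sums)
  then show ?thesis
    by (simp add: eval_fps_def sums_iff)
qed

lemma W_series_conv_radius: "norm z < fps_conv_radius (W_series u)"
proof -
  have "norm z < 1 / (1 + norm u)"
    using small by (simp add: field_simps add_pos_nonneg)
  then obtain r where r: "norm z < r" "r < 1 / (1 + norm u)"
    using dense by blast
  then have "0 < r" using norm_ge_zero le_less_trans by blast
  with r have r1: "norm (complex_of_real r) * (1 + norm u) < 1"
    by (simp add: field_simps add_pos_nonneg)
  have "summable (\<lambda>n. poly (W_fps $ n) u * complex_of_real r ^ n)"
  proof (rule summable_comparison_test')
    show "summable (\<lambda>n. (norm (complex_of_real r) * (1 + norm u)) ^ n)"
      using r1 by (intro summable_geometric) (simp add: abs_mult)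
  qed (rule norm_W_fps_coeff_le)
  then have "ereal (norm (complex_of_real r)) \<le> fps_conv_radius (W_series u)"
    unfolding fps_conv_radius_def by (intro conv_radius_geI) (simp add: W_series_def)
  then show ?thesis
    using \<open>0 < r\<close> r(1) less_le_trans[of "ereal (norm z)" "ereal r"] by simp
qed

text \<open>
  The formal identity holds for values because all series involved converge at \<open>z\<close>: the
  exponentials everywhere and \<open>W_series u\<close> in a disc that contains \<open>z\<close>.
\<close>

lemma W_times_denominator:
  "W z u * (exp (z * alpha u) * (alpha u - 1) + exp (- z * alpha u) * (alpha u + 1))
    = u * (exp (z * alpha u) - exp (- z * alpha u))"
proof -
  define \<alpha> where "\<alpha> = alpha u"
  have "\<alpha>\<^sup>2 = 1 - u" by (simp add: \<alpha>_def alpha_def)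
  note eq = W_series_closed_form[OF this]
  let ?D = "fps_const (\<alpha> - 1) * fps_exp \<alpha> + fps_const (\<alpha> + 1) * fps_exp (- \<alpha>)"
  have rad: "fps_conv_radius (fps_const c * fps_exp d) = \<infinity>" for c d :: complex
    by (cases "c = 0") (auto simp: fps_conv_radius_cmult_left)
  have rad_D: "fps_conv_radius ?D = \<infinity>"
    using fps_conv_radius_add[of "fps_const (\<alpha> - 1) * fps_exp \<alpha>" "fps_const (\<alpha> + 1) * fps_exp (- \<alpha>)"]
    by (simp add: rad)
  have rad_N: "fps_conv_radius (fps_exp \<alpha> - fps_exp (- \<alpha>)) = \<infinity>"
    using fps_conv_radius_diff[of "fps_exp \<alpha>" "fps_exp (- \<alpha>)"] by simp
  have D: "eval_fps ?D z = (\<alpha> - 1) * exp (\<alpha> * z) + (\<alpha> + 1) * exp (- \<alpha> * z)"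
    by (simp add: eval_fps_add eval_fps_mult rad)
  have "W z u * eval_fps ?D z = eval_fps (W_series u * ?D) z"
    using W_series_conv_radius rad_D by (simp add: eval_fps_mult W_eq_eval_fps)
  also have "\<dots> = u * (exp (\<alpha> * z) - exp (- \<alpha> * z))"
    unfolding eq by (simp add: eval_fps_mult eval_fps_diff rad_N)
  finally show ?thesis
    unfolding D \<alpha>_def[symmetric] by (simp add: mult_ac)
qed

text \<open>
  If the denominator vanished, so would the numerator \<open>u * (P - Q)\<close> with \<open>P = exp (z * \<alpha>)\<close> and
  \<open>Q = exp (- z * \<alpha>)\<close>. But for \<open>u = 0\<close> one has \<open>\<alpha> = 1\<close> and the denominator is \<open>2 * Q\<close>, while for \<open>P = Q\<close>
  it is \<open>2 * \<alpha> * Q\<close>. So convergence of \<open>W\<close> alone excludes poles of the closed form.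
\<close>

lemma denominator_nonzero:
  assumes "u \<noteq> 1"
  shows "exp (z * alpha u) * (alpha u - 1) + exp (- z * alpha u) * (alpha u + 1) \<noteq> 0"
proof
  define P where "P = exp (z * alpha u)"
  define Q where "Q = exp (- z * alpha u)"
  assume zero: "exp (z * alpha u) * (alpha u - 1) + exp (- z * alpha u) * (alpha u + 1) = 0"
  have "u * (P - Q) = 0"
    using W_times_denominator unfolding zero P_def Q_def by (metis mult_zero_right)
  then consider "u = 0" | "P = Q" by auto
  then show False
  proof cases
    case 1
    then show False using zero by (simp add: alpha_def)
  next
    case 2
    have "Q * (2 * alpha u) = 0"
      using zero unfolding P_def[symmetric] Q_def[symmetric] 2 by algebra
    then have "alpha u = 0" by (simp add: Q_def)
    then show False using assms by (simp add: alpha_def)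
  qed
qed

text \<open>
  The zeros of \<open>sinh\<close> are the integer multiples of \<open>\<pi> * \<i>\<close>, and \<open>norm (z * \<alpha>) \<le> norm z * (1 + norm u) < 1 < \<pi>\<close>.
\<close>

lemma sinh_nonzero:
  assumes "z \<noteq> 0" "u \<noteq> 1"
  shows "sinh (z * alpha u) \<noteq> 0"
proof
  define x where "x = z * alpha u"
  assume "sinh (z * alpha u) = 0"
  then have "exp x ^ 2 = 1"
    by (auto simp: sinh_zero_iff x_def)
  then have "exp (2 * x) = 1"
    by (simp add: exp_double)
  then obtain k :: int where "Re x = 0" and "Im x = of_int k * pi"
    unfolding exp_eq_1 by auto
  then have norm_eq: "norm x = \<bar>of_int k\<bar> * pi"
    by (simp add: cmod_def abs_mult)
  have "norm x ^ 2 = norm (z ^ 2 * (1 - u))"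
    by (simp add: x_def alpha_def power_mult_distrib flip: norm_power)
  also have "\<dots> \<le> norm z ^ 2 * (1 + norm u)"
    using norm_triangle_ineq4[of 1 u] by (simp add: norm_mult norm_power mult_left_mono)
  also have "\<dots> \<le> norm z ^ 2 * (1 + norm u) ^ 2"
    by (intro mult_left_mono self_le_power) auto
  also have "\<dots> = (norm z * (1 + norm u)) ^ 2"
    by (rule power_mult_distrib[symmetric])
  also have "\<dots> < 1"
    using power_strict_mono[OF small, of 2] by simp
  finally have "norm x < 1"
    by (simp add: abs_square_less_1)
  moreover have "x \<noteq> 0"
    using assms by (simp add: x_def alpha_def)
  then have "k \<noteq> 0" using norm_eq by auto
  then have "1 \<le> \<bar>real_of_int k\<bar>" by linarith
  then have "pi \<le> norm x"
    unfolding norm_eq using mult_right_mono[of 1 "\<bar>real_of_int k\<bar>" pi] pi_gt_zero by linarith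
  ultimately show False using pi_gt3 by linarith
qed

end

section \<open>Continuity and filling in\<close>

definition convergence_domain :: "(complex \<times> complex) set" where
  "convergence_domain = {p. norm (fst p) * (1 + norm (snd p)) < 1}"

lemma open_convergence_domain: "open convergence_domain"
  unfolding convergence_domain_def by (intro open_Collect_less continuous_intros)

text \<open>
  The partial sums are polynomials in \<open>z\<close> and \<open>u\<close>. They converge uniformly on each of the sets where
  \<open>norm z * (1 + norm u)\<close> stays below some \<open>c < 1\<close>, by comparison with a geometric series, and these
  open sets exhaust the domain.
\<close>

lemma continuous_on_W: "continuous_on convergence_domain (\<lambda>(z, u). W z u)"
proof -
  let ?f = "\<lambda>p :: complex \<times> complex. norm (fst p) * (1 + norm (snd p))"
  have "continuous_on {p. ?f p < c} (\<lambda>(z, u). W z u)" if c: "0 < c" "c < 1" for c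
  proof -
    have "uniform_limit {p. ?f p < c}
        (\<lambda>n p. \<Sum>i<n. poly (W_fps $ i) (snd p) * fst p ^ i)
        (\<lambda>p. \<Sum>i. poly (W_fps $ i) (snd p) * fst p ^ i) sequentially"
    proof (rule Weierstrass_m_test)
      show "summable (\<lambda>n. c ^ n)" using c by (intro summable_geometric) simp
      show "norm (poly (W_fps $ n) (snd p) * fst p ^ n) \<le> c ^ n" if "p \<in> {p. ?f p < c}" for n p
        using norm_W_fps_coeff_le[of n "snd p" "fst p"] that
          power_mono[of "?f p" c n] by (simp add: le_less_trans)
    qed
    then have "continuous_on {p. ?f p < c} (\<lambda>p. \<Sum>i. poly (W_fps $ i) (snd p) * fst p ^ i)"
      by (rule uniform_limit_theorem[rotated]) (auto intro!: continuous_intros always_eventually)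
    also have "?this \<longleftrightarrow> ?thesis"
      using c by (intro continuous_on_cong) (auto simp: W_eq_eval_fps eval_fps_def)
    finally show ?thesis .
  qed
  moreover have "open {p. ?f p < c}" for c
    by (intro open_Collect_less continuous_intros)
  ultimately have "continuous_on (\<Union>c\<in>{0<..<1}. {p. ?f p < c}) (\<lambda>(z, u). W z u)"
    by (intro continuous_on_open_UN) auto
  moreover have "(\<Union>c\<in>{0<..<1}. {p. ?f p < c}) = convergence_domain"
  proof -
    have "\<exists>c\<in>{0<..<1}. ?f p < c" if "?f p < 1" for p
    proof -
      obtain c where "?f p < c" "c < 1" using dense[OF \<open>?f p < 1\<close>] by blast
      moreover have "0 \<le> ?f p" by simp
      ultimately have "c \<in> {0<..<1}" unfolding greaterThanLessThan_iff by linarith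
      with \<open>?f p < c\<close> show ?thesis by blast
    qed
    then show ?thesis
      unfolding convergence_domain_def by (force intro: less_trans)
  qed
  ultimately show ?thesis by simp
qed

text \<open>
  A continuous function that agrees with \<open>f\<close> where \<open>f\<close> is defined supplies the filled-in values, provided
  that the domain of \<open>f\<close> is dense. It is enough that the exceptional points lie on two lines
  \<open>z = a\<close> and \<open>u = b\<close>, because the complement of two such lines is dense.
\<close>

lemma has_filled_value_continuous:
  fixes f g :: "complex \<times> complex \<Rightarrow> complex"
  assumes S: "open S" and p: "p \<in> S" and g: "continuous_on S g"
    and eq: "\<And>q. q \<in> S \<Longrightarrow> q \<in> D \<Longrightarrow> f q = g q"
    and dense: "S \<inter> ((- {a}) \<times> (- {b})) \<subseteq> D"
  shows "has_filled_value f D p (g p)"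
proof (cases "p \<in> D")
  case False
  have "closure ((- {a}) \<times> (- {b})) = UNIV"
    by (simp add: closure_Times closure_complement)
  then have "p \<in> closure (S \<inter> ((- {a}) \<times> (- {b})))"
    using open_Int_closure_subset[OF S] p by blast
  then have "p \<in> closure D"
    using closure_mono[OF dense] by blast
  then have "p islimpt D"
    using False by (simp add: closure_def)
  moreover have "(g \<longlongrightarrow> g p) (at p within D)"
    using continuous_on_eq_continuous_at[OF S] g p
    by (metis continuous_at continuous_at_imp_continuous_at_within continuous_within)
  then have "(f \<longlongrightarrow> g p) (at p within D)"
  proof (rule Lim_transform_eventually)
    have "eventually (\<lambda>q. q \<in> S) (at p within D)"
      using S p by (rule eventually_at_in_open'[THEN filter_leD[OF at_le, rotated]]) simp
    then show "eventually (\<lambda>q. g q = f q) (at p within D)"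
      by (rule eventually_mp[rotated]) (auto simp: eq eventually_at_filter)
  qed
  ultimately show ?thesis using False by (simp add: has_filled_value_def)
qed (simp add: has_filled_value_def eq p)

lemma alpha_coth_minus_1:
  assumes "sinh (z * \<alpha>) \<noteq> 0"
  shows "\<alpha> * coth (z * \<alpha>) - 1 =
    (exp (z * \<alpha>) * (\<alpha> - 1) + exp (- z * \<alpha>) * (\<alpha> + 1)) / (exp (z * \<alpha>) - exp (- z * \<alpha>))"
proof -
  have "exp (z * \<alpha>) - exp (- z * \<alpha>) = 2 * sinh (z * \<alpha>)"
    "exp (z * \<alpha>) + exp (- z * \<alpha>) = 2 * cosh (z * \<alpha>)"
    by (simp_all add: sinh_def cosh_def scaleR_conv_of_real)
  moreover have "exp (z * \<alpha>) * (\<alpha> - 1) + exp (- z * \<alpha>) * (\<alpha> + 1) =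
     \<alpha> * (exp (z * \<alpha>) + exp (- z * \<alpha>)) - (exp (z * \<alpha>) - exp (- z * \<alpha>))"
    by (simp add: algebra_simps)
  ultimately show ?thesis using assms by (simp add: coth_def field_simps)
qed

text \<open>
  The third closed form is the second one expanded by \<open>exp (z * \<alpha>)\<close>.
\<close>

lemma exp_double_ratio:
  fixes z \<alpha> :: complex
  shows "exp (2 * z * \<alpha>) * (\<alpha> - 1) + \<alpha> + 1 =
      exp (z * \<alpha>) * (exp (z * \<alpha>) * (\<alpha> - 1) + exp (- z * \<alpha>) * (\<alpha> + 1))"
    and "exp (2 * z * \<alpha>) - 1 = exp (z * \<alpha>) * (exp (z * \<alpha>) - exp (- z * \<alpha>))"
proof -
  have "exp (2 * z * \<alpha>) = exp (z * \<alpha>) * exp (z * \<alpha>)" "exp (z * \<alpha>) * exp (- z * \<alpha>) = 1"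
    using exp_double[of "z * \<alpha>"] exp_minus_inverse[of "z * \<alpha>"]
    by (simp_all only: power2_eq_square mult.assoc mult_minus_left)
  then show "exp (2 * z * \<alpha>) * (\<alpha> - 1) + \<alpha> + 1 =
      exp (z * \<alpha>) * (exp (z * \<alpha>) * (\<alpha> - 1) + exp (- z * \<alpha>) * (\<alpha> + 1))"
    and "exp (2 * z * \<alpha>) - 1 = exp (z * \<alpha>) * (exp (z * \<alpha>) - exp (- z * \<alpha>))"
    by algebra+
qed

theorem theorem1:
  "\<exists>S :: (complex \<times> complex) set. open S \<and> {0} \<times> UNIV \<subseteq> S \<and>
     (\<forall>(z, u) \<in> S.
        W_term z u summable_on W_index \<and>
        has_filled_value coth_form coth_dom (z, u) (W z u) \<and>
        has_filled_value exp_form exp_dom (z, u) (W z u) \<and>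
        has_filled_value exp2_form exp2_dom (z, u) (W z u))"
proof (intro exI[of _ convergence_domain] conjI open_convergence_domain)
  \<comment> \<open>At \<open>z = 0\<close> the condition \<open>norm z * (1 + norm u) < 1\<close> puts no bound on \<open>u\<close>.\<close>
  show "{0} \<times> UNIV \<subseteq> convergence_domain"
    by (auto simp: convergence_domain_def)
  have small: "norm z * (1 + norm u) < 1" if "(z, u) \<in> convergence_domain" for z u
    using that by (simp add: convergence_domain_def)
  \<comment> \<open>All exceptional points of the three closed forms have \<open>z = 0\<close> or \<open>u = 1\<close>.\<close>
  have filled: "has_filled_value f D (z, u) (W z u)"
    if "(z, u) \<in> convergence_domain"
      and "\<And>z u. (z, u) \<in> convergence_domain \<Longrightarrow> (z, u) \<in> D \<Longrightarrow> f (z, u) = W z u"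
      and "\<And>z u. (z, u) \<in> convergence_domain \<Longrightarrow> z \<noteq> 0 \<Longrightarrow> u \<noteq> 1 \<Longrightarrow> (z, u) \<in> D"
    for f D z u
    using has_filled_value_continuous[OF open_convergence_domain that(1) continuous_on_W,
        of D f 0 1] that(2,3) by auto
  have W_eq: "u * ((exp (z * alpha u) - exp (- z * alpha u)) /
      (exp (z * alpha u) * (alpha u - 1) + exp (- z * alpha u) * (alpha u + 1))) = W z u"
    if "(z, u) \<in> convergence_domain"
      and "exp (z * alpha u) * (alpha u - 1) + exp (- z * alpha u) * (alpha u + 1) \<noteq> 0" for z u
    using W_times_denominator[OF small[OF that(1)]] that(2) by (simp add: divide_simps mult_ac)
  show "\<forall>(z, u)\<in>convergence_domain.
      W_term z u summable_on W_index \<and>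
      has_filled_value coth_form coth_dom (z, u) (W z u) \<and>
      has_filled_value exp_form exp_dom (z, u) (W z u) \<and>
      has_filled_value exp2_form exp2_dom (z, u) (W z u)"
  proof (clarify, intro conjI)
    fix z u assume zu: "(z, u) \<in> convergence_domain"
    show "W_term z u summable_on W_index"
      using W_term_summable[OF small[OF zu]] .
    show "has_filled_value coth_form coth_dom (z, u) (W z u)"
    proof (rule filled[OF zu])
      fix z u assume in_dom: "(z, u) \<in> convergence_domain"
      define N where "N = exp (z * alpha u) - exp (- z * alpha u)"
      define D where "D = exp (z * alpha u) * (alpha u - 1) + exp (- z * alpha u) * (alpha u + 1)"
      have N: "N = 2 * sinh (z * alpha u)"
        by (simp add: N_def sinh_def scaleR_conv_of_real)
      have D: "alpha u * coth (z * alpha u) - 1 = D / N" if "sinh (z * alpha u) \<noteq> 0"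
        using alpha_coth_minus_1[OF that] by (simp only: D_def N_def)
      show "coth_form (z, u) = W z u" if "(z, u) \<in> coth_dom"
      proof -
        have "sinh (z * alpha u) \<noteq> 0" and "D / N \<noteq> 0"
          using that D by (auto simp: coth_dom_def simp flip: alpha_def)
        then have "coth_form (z, u) = u * (N / D)"
          using D by (simp add: coth_form_def flip: alpha_def)
        also have "\<dots> = W z u"
          using W_eq[OF in_dom] \<open>D / N \<noteq> 0\<close> unfolding D_def N_def by force
        finally show ?thesis .
      qed
      show "(z, u) \<in> coth_dom" if "z \<noteq> 0" "u \<noteq> 1"
      proof -
        have "sinh (z * alpha u) \<noteq> 0"
          by (rule sinh_nonzero[OF small[OF in_dom] that])
        moreover have "D / N \<noteq> 0"
          using denominator_nonzero[OF small[OF in_dom] that(2)] calculation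
          unfolding N D_def by (metis divide_eq_0_iff mult_eq_0_iff zero_neq_numeral)
        ultimately show ?thesis
          using D unfolding coth_dom_def alpha_def[symmetric] by force
      qed
    qed
    show "has_filled_value exp_form exp_dom (z, u) (W z u)"
    proof (rule filled[OF zu])
      fix z u assume in_dom: "(z, u) \<in> convergence_domain"
      show "exp_form (z, u) = W z u" if "(z, u) \<in> exp_dom"
        using that unfolding exp_form_def exp_dom_def Let_def prod.case mem_Collect_eq
        by (rule W_eq[OF in_dom])
      show "(z, u) \<in> exp_dom" if "u \<noteq> 1"
        unfolding exp_dom_def Let_def prod.case mem_Collect_eq
        by (rule denominator_nonzero[OF small[OF in_dom] that])
    qed
    show "has_filled_value exp2_form exp2_dom (z, u) (W z u)"
    proof (rule filled[OF zu])
      fix z u assume in_dom: "(z, u) \<in> convergence_domain"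
      show "exp2_form (z, u) = W z u" if "(z, u) \<in> exp2_dom"
        using that
        unfolding exp2_form_def exp2_dom_def Let_def prod.case mem_Collect_eq exp_double_ratio
          mult_divide_mult_cancel_left[OF exp_not_eq_zero] mult_eq_0_iff de_Morgan_disj
        by (elim conjE) (rule W_eq[OF in_dom])
      show "(z, u) \<in> exp2_dom" if "u \<noteq> 1"
        unfolding exp2_dom_def Let_def prod.case mem_Collect_eq exp_double_ratio
        by (intro no_zero_divisors exp_not_eq_zero denominator_nonzero[OF small[OF in_dom] that])
    qed
  qed
qed

end
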